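(* Let $n\ge 2$ and $k\ge 0$ be integers with $k\le F_{n-2}$. Then $$c_{F_{n+2}+k}=c_{F_n+k}+c_k+c_{F_{n-1}+k}.$$
   Context: $F_n$ is the $n$th Fibonacci number ($F_0=0$, $F_1=1$, $F_{n+1}=F_n+F_{n-1}$). For an integer $n\ge 0$, $s_F(n)$ is the number of terms in the Zeckendorf representation of $n$ (the unique representation of $n$ as a sum of distinct, pairwise non-consecutive Fibonacci numbers $F_i$, $i\ge2$), with $s_F(0)=0$. Let $\sigma=(1+\sqrt{-3})/2$ and $\overline\sigma$ its complex conjugate. The sequence $(c_n)$ is defined by $$c_{n+1}=\sum_{k=0}^n\sigma^{s_F(k)}\,\overline\sigma^{\,s_F(n-k)}\quad(n\ge 0),$$ and $c_0=0$ (the empty sum). *)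

theory Defs
  imports Complex_Main "HOL-Number_Theory.Fib"
begin

text \<open>A Zeckendorf representation is encoded by its set of Fibonacci indices. All indices
  are at least 2, so distinct indices give distinct Fibonacci numbers.\<close>

definition zeckendorf_rep :: "nat set \<Rightarrow> nat \<Rightarrow> bool" where
  "zeckendorf_rep S n \<longleftrightarrow>
     finite S \<and> (\<forall>i\<in>S. 2 \<le> i) \<and> (\<forall>i\<in>S. Suc i \<notin> S) \<and> (\<Sum>i\<in>S. fib i) = n"

definition s_F :: "nat \<Rightarrow> nat" where
  "s_F n = card (THE S. zeckendorf_rep S n)"

definition \<sigma> :: complex where
  "\<sigma> = (1 + \<i> * complex_of_real (sqrt 3)) / 2"

primrec c_seq :: "nat \<Rightarrow> complex" where
  "c_seq 0 = 0"
| "c_seq (Suc n) = (\<Sum>k\<le>n. \<sigma> ^ s_F k * cnj \<sigma> ^ s_F (n - k))"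

text \<open>Zeckendorf's theorem, which justifies the definite description in \<^const>\<open>s_F\<close>.\<close>

lemma zeckendorf_sum_less:
  assumes "zeckendorf_rep S n" and "\<forall>i\<in>S. i \<le> m"
  shows "n < fib (Suc m)"
  using assms
proof (induction m arbitrary: S n rule: less_induct)
  case (less m)
  note Z = less.prems(1)[unfolded zeckendorf_rep_def]
  show ?case
  proof (cases "m < 2")
    case True
    then have "S = {}" using Z less.prems(2) by fastforce
    then have "n = 0" using Z by simp
    then show ?thesis by (simp add: fib_neq_0_nat)
  next
    case False
    then obtain k where k: "m = Suc (Suc k)"
      by (metis One_nat_def Suc_1 less_2_cases_iff not0_implies_Suc)
    show ?thesis
    proof (cases "m \<in> S")
      case True
      have sum: "fib m + (\<Sum>i\<in>S - {m}. fib i) = n"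
        using Z True sum.remove[of S m fib] by simp
      have le: "i \<le> k" if "i \<in> S - {m}" for i
      proof -
        have "i \<le> m" "i \<noteq> m" using less.prems(2) that by auto
        moreover have "i \<noteq> Suc k" using Z True that k by auto
        ultimately show ?thesis using k by linarith
      qed
      have "zeckendorf_rep (S - {m}) (\<Sum>i\<in>S - {m}. fib i)"
        using Z by (simp add: zeckendorf_rep_def)
      then have "(\<Sum>i\<in>S - {m}. fib i) < fib (Suc k)"
        using less.IH[of k] le k by simp
      then show ?thesis using sum k by simp
    next
      case False
      then have "\<forall>i\<in>S. i \<le> Suc k"
        using less.prems(2) k le_Suc_eq by metis
      then have "n < fib (Suc (Suc k))" using less.IH[of "Suc k"] less.prems(1) k by blast
      then show ?thesis using k by simp
    qed
  qed
qed

lemma fib_le_lessD: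
  assumes "fib a \<le> n" "n < fib (Suc b)"
  shows "a \<le> b"
proof (rule ccontr)
  assume "\<not> a \<le> b"
  then have "fib (Suc b) \<le> fib a" by (intro fib_mono) simp
  then show False using assms by simp
qed

lemma zeckendorf_Max:
  assumes "zeckendorf_rep S n" "S \<noteq> {}"
  shows "fib (Max S) \<le> n" "n < fib (Suc (Max S))"
proof -
  have fin: "finite S" using assms by (simp add: zeckendorf_rep_def)
  then have "fib (Max S) \<le> (\<Sum>i\<in>S. fib i)"
    using assms(2) by (intro member_le_sum) auto
  then show "fib (Max S) \<le> n" using assms by (simp add: zeckendorf_rep_def)
  show "n < fib (Suc (Max S))"
    using zeckendorf_sum_less[OF assms(1)] fin by simp
qed

lemma zeckendorf_unique:
  assumes "zeckendorf_rep S n" "zeckendorf_rep T n"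
  shows "S = T"
  using assms
proof (induction n arbitrary: S T rule: less_induct)
  case (less n)
  have empty: "A = {}" if "zeckendorf_rep A 0" for A
    using zeckendorf_Max(1)[OF that] that
    by (metis Max_in fib_neq_0_nat le_zero_eq not_numeral_le_zero not_gr_zero zeckendorf_rep_def)
  show ?case
  proof (cases "n = 0")
    case True
    then show ?thesis using empty less.prems by metis
  next
    case False
    then have ne: "S \<noteq> {}" "T \<noteq> {}" using less.prems by (auto simp: zeckendorf_rep_def)
    define m where "m = Max S"
    note S = zeckendorf_Max[OF less.prems(1) ne(1)] and T = zeckendorf_Max[OF less.prems(2) ne(2)]
    have mT: "m = Max T"
      unfolding m_def using fib_le_lessD[OF S(1) T(2)] fib_le_lessD[OF T(1) S(2)] by (rule antisym)
    have mem: "m \<in> S" "m \<in> T"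
      using Max_in[of S] Max_in[of T] ne less.prems unfolding zeckendorf_rep_def
      by (simp add: m_def, simp add: mT)
    then have pos: "0 < fib m" using less.prems by (force simp: zeckendorf_rep_def fib_neq_0_nat)
    have rem: "zeckendorf_rep (A - {m}) (n - fib m)" if "zeckendorf_rep A n" "m \<in> A" for A
      using that sum.remove[of A m fib] by (auto simp: zeckendorf_rep_def)
    have "S - {m} = T - {m}"
      using less.IH[of "n - fib m"] rem less.prems mem pos False by simp
    then show ?thesis using mem by blast
  qed
qed

lemma zeckendorf_exists: "\<exists>S. zeckendorf_rep S n"
proof (induction n rule: less_induct)
  case (less n)
  show ?case
  proof (cases "n = 0")
    case True
    then have "zeckendorf_rep {} n" by (simp add: zeckendorf_rep_def)
    then show ?thesis ..
  next
    case False
    have grow: "k < fib (Suc (Suc k))" for k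
    proof (induction k)
      case (Suc k)
      have "0 < fib (Suc k)" by (simp add: fib_neq_0_nat)
      then show ?case using Suc by simp
    qed simp
    define j where "j = (LEAST j. n < fib (Suc j))"
    have j: "n < fib (Suc j)"
      unfolding j_def using grow by (rule LeastI)
    have j2: "2 \<le> j"
    proof (rule ccontr)
      assume "\<not> 2 \<le> j"
      then have "j = 0 \<or> j = 1" by auto
      then show False using j False by auto
    qed
    then obtain i where i: "j = Suc (Suc i)"
      by (metis add_2_eq_Suc le_Suc_ex)
    have le: "fib j \<le> n"
      using not_less_Least[of "Suc i" "\<lambda>j. n < fib (Suc j)"] i j_def by simp
    have "0 < fib j" using j2 by (simp add: fib_neq_0_nat)
    then have "n - fib j < n" using False by simp
    then obtain S where S: "zeckendorf_rep S (n - fib j)" using less.IH by blast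
    have small: "n - fib j < fib (Suc i)" using j i le by simp
    have bound: "a \<le> i" if "a \<in> S" for a
    proof -
      have "fib a \<le> n - fib j"
        using S that member_le_sum[of a S fib] by (auto simp: zeckendorf_rep_def)
      then show ?thesis using small fib_le_lessD by blast
    qed
    have "j \<notin> S" "Suc j \<notin> S" "\<forall>a\<in>S. Suc a \<noteq> j" using bound i by force+
    then have "zeckendorf_rep (insert j S) n"
      using S le j2 by (auto simp: zeckendorf_rep_def)
    then show ?thesis ..
  qed
qed

lemma zeckendorf_ex1: "\<exists>!S. zeckendorf_rep S n"
  using zeckendorf_exists zeckendorf_unique by blast

lemma s_F_eq: "zeckendorf_rep S n \<Longrightarrow> s_F n = card S"
  unfolding s_F_def using zeckendorf_unique by (metis the_equality)

end

theory Submission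
  imports Defs "HOL-Computational_Algebra.Formal_Power_Series"
begin

unbundle fps_syntax

text \<open>Let $f = \sum_j \sigma^{s_F(j)} x^j$, with conjugate $g$, so that $c_n$ is the coefficient
  of $x^n$ in $x f g$. The truncations $A_n$ of $f$ and $B_n$ of $g$ below degree $F_n$ satisfy
  $A_{n+2} = A_{n+1} + \sigma x^{F_{n+1}} A_n$, and the same for $B_n$ with $\overline\sigma$.
  Because $\sigma + \overline\sigma = \sigma\overline\sigma = 1$, expanding $A_{n+1} B_{n+1}$ once
  shows that the coefficient of $x^{F_n+k}$ in $x A_n B_n$ is $c_{F_n+k} - c_k$ for
  $k \le F_{n-1}$. Expanding $A_{n+2} B_{n+2}$ down to $A_n B_n$ and $A_{n-1} B_{n-1}$, all
  remaining terms vanish for degree reasons.\<close>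

lemma sigma_mult_cnj [simp]: "\<sigma> * cnj \<sigma> = 1"
  by (simp add: \<sigma>_def complex_eq_iff field_simps)

lemma sigma_add_cnj [simp]: "\<sigma> + cnj \<sigma> = 1"
  by (simp add: \<sigma>_def complex_eq_iff)

text \<open>Every index in the representation of \<open>j\<close> is at most \<open>m - 1\<close>,
  so \<open>Suc m\<close> can be adjoined without creating neighbours.\<close>

lemma s_F_fib_add:
  assumes "j < fib m"
  shows "s_F (fib (Suc m) + j) = Suc (s_F j)"
proof -
  obtain S where S: "zeckendorf_rep S j" using zeckendorf_exists by blast
  obtain l where l: "m = Suc l" using assms by (cases m) auto
  have bound: "a \<le> l" if "a \<in> S" for a
  proof -
    have "fib a \<le> j"
      using S that member_le_sum[of a S fib] by (auto simp: zeckendorf_rep_def)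
    then show ?thesis using assms l fib_le_lessD by blast
  qed
  have notin: "Suc m \<notin> S" "Suc (Suc m) \<notin> S" "\<forall>a\<in>S. Suc a \<noteq> Suc m"
    using bound l by force+
  then have "zeckendorf_rep (insert (Suc m) S) (fib (Suc m) + j)"
    using S l by (auto simp: zeckendorf_rep_def)
  then have "s_F (fib (Suc m) + j) = card (insert (Suc m) S)"
    by (rule s_F_eq)
  then show ?thesis
    using S notin(1) s_F_eq[OF S] by (simp add: zeckendorf_rep_def)
qed

definition weight_fps :: "complex \<Rightarrow> complex fps" where
  "weight_fps w = Abs_fps (\<lambda>j. w ^ s_F j)"

definition weight_trunc :: "complex \<Rightarrow> nat \<Rightarrow> complex fps" where
  "weight_trunc w n = fps_cutoff (fib n) (weight_fps w)"

lemma weight_trunc_nth: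
  "weight_trunc w n $ j = (if j < fib n then w ^ s_F j else 0)"
  by (simp add: weight_trunc_def weight_fps_def)

text \<open>The exponents gained are \<open>fib (Suc n) + i\<close> with \<open>i < fib n\<close>;
  by \<open>s_F_fib_add\<close> each carries one more factor \<open>w\<close> than
  \<open>i\<close>.\<close>

lemma weight_trunc_rec:
  "weight_trunc w (Suc (Suc n)) =
     weight_trunc w (Suc n) + fps_const w * (fps_X ^ fib (Suc n) * weight_trunc w n)"
proof (rule fps_ext)
  fix j
  show "weight_trunc w (Suc (Suc n)) $ j =
    (weight_trunc w (Suc n) + fps_const w * (fps_X ^ fib (Suc n) * weight_trunc w n)) $ j"
  proof (cases "fib (Suc n) \<le> j \<and> j < fib (Suc (Suc n))")
    case True
    then obtain i where "j = fib (Suc n) + i" "i < fib n"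
      by (metis add_less_cancel_left fib.simps(3) add.commute le_Suc_ex)
    then show ?thesis
      by (simp add: weight_trunc_nth fps_X_power_mult_nth s_F_fib_add)
  next
    case False
    then show ?thesis
      by (auto simp: weight_trunc_nth fps_X_power_mult_nth)
  qed
qed

text \<open>The indices are separate because expanding one factor at a time produces mixed products;
  \<open>fps_X\<close> matches the index shift in \<open>c_seq\<close>.\<close>

definition trunc_prod :: "nat \<Rightarrow> nat \<Rightarrow> complex fps" where
  "trunc_prod m n = fps_X * (weight_trunc \<sigma> m * weight_trunc (cnj \<sigma>) n)"

lemma trunc_prod_nth_0 [simp]: "trunc_prod m n $ 0 = 0"
  by (simp add: trunc_prod_def)

lemma trunc_prod_nth_Suc:
  "trunc_prod m n $ Suc j = (\<Sum>l\<le>j. weight_trunc \<sigma> m $ l * weight_trunc (cnj \<sigma>) n $ (j - l))"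
proof -
  have "trunc_prod m n $ Suc j = (weight_trunc \<sigma> m * weight_trunc (cnj \<sigma>) n) $ j"
    by (simp add: trunc_prod_def)
  then show ?thesis by (simp only: fps_mult_nth atMost_atLeast0)
qed

text \<open>Nonzero terms of the factors have exponents below \<open>fib m\<close> and
  \<open>fib n\<close>, and \<open>fps_X\<close> adds only one.\<close>

lemma trunc_prod_nth_high:
  assumes "fib m + fib n \<le> i"
  shows "trunc_prod m n $ i = 0"
proof (cases i)
  case (Suc j)
  then have "weight_trunc \<sigma> m $ l * weight_trunc (cnj \<sigma>) n $ (j - l) = 0" for l
    using assms by (auto simp: weight_trunc_nth)
  then show ?thesis
    using Suc by (simp add: trunc_prod_nth_Suc del: mult_eq_0_iff)
qed simp

text \<open>Only exponents below \<open>i\<close> contribute, and there neither truncation has any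
  effect; the shift by \<open>fps_X\<close> allows equality in the bounds.\<close>

lemma trunc_prod_nth_low:
  assumes "i \<le> fib m" "i \<le> fib n"
  shows "trunc_prod m n $ i = c_seq i"
proof (cases i)
  case (Suc j)
  have "weight_trunc \<sigma> m $ l * weight_trunc (cnj \<sigma>) n $ (j - l)
      = \<sigma> ^ s_F l * cnj \<sigma> ^ s_F (j - l)" if "l \<le> j" for l
    using assms Suc that by (simp add: weight_trunc_nth)
  then show ?thesis
    using Suc by (simp add: trunc_prod_nth_Suc)
qed simp

text \<open>Truncated subtraction is harmless here, since the constant coefficient is 0.\<close>

lemma trunc_prod_nth_rec_left:
  "trunc_prod (Suc (Suc m)) n $ i =
     trunc_prod (Suc m) n $ i + \<sigma> * trunc_prod m n $ (i - fib (Suc m))"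
proof -
  have "trunc_prod (Suc (Suc m)) n =
      trunc_prod (Suc m) n + fps_const \<sigma> * (fps_X ^ fib (Suc m) * trunc_prod m n)"
    by (simp add: trunc_prod_def weight_trunc_rec algebra_simps del: fib.simps)
  then show ?thesis by (simp add: fps_X_power_mult_nth del: fib.simps)
qed

lemma trunc_prod_nth_rec_right:
  "trunc_prod m (Suc (Suc n)) $ i =
     trunc_prod m (Suc n) $ i + cnj \<sigma> * trunc_prod m n $ (i - fib (Suc n))"
proof -
  have "trunc_prod m (Suc (Suc n)) =
      trunc_prod m (Suc n) + fps_const (cnj \<sigma>) * (fps_X ^ fib (Suc n) * trunc_prod m n)"
    by (simp add: trunc_prod_def weight_trunc_rec algebra_simps del: fib.simps)
  then show ?thesis by (simp add: fps_X_power_mult_nth del: fib.simps)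
qed

text \<open>Both factors are expanded once; the doubly shifted term has coefficient
  \<open>\<sigma> * cnj \<sigma> = 1\<close>.\<close>

lemma trunc_prod_diag_nth:
  "trunc_prod (Suc (Suc m)) (Suc (Suc m)) $ i =
     trunc_prod (Suc m) (Suc m) $ i
     + (\<sigma> * trunc_prod m (Suc m) $ (i - fib (Suc m))
        + cnj \<sigma> * trunc_prod (Suc m) m $ (i - fib (Suc m)))
     + trunc_prod m m $ (i - 2 * fib (Suc m))"
proof -
  have "cnj \<sigma> * \<sigma> = 1"
    by (metis mult.commute sigma_mult_cnj)
  then show ?thesis
    by (simp add: trunc_prod_nth_rec_left trunc_prod_nth_rec_right[of _ m] distrib_left mult_2
        mult.assoc[symmetric] del: fib.simps)
qed

lemma sigma_cnj_combine: "\<sigma> * z + cnj \<sigma> * z = z"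
  by (metis distrib_right mult_1 sigma_add_cnj)

lemma trunc_prod_diag_nth_fib:
  assumes "k \<le> fib m"
  shows "trunc_prod (Suc m) (Suc m) $ (fib (Suc m) + k) = c_seq (fib (Suc m) + k) - c_seq k"
proof -
  have "fib m \<le> fib (Suc m)" by (rule fib_mono) simp
  then have k: "k \<le> fib (Suc m)" using assms by simp
  have "c_seq (fib (Suc m) + k) = trunc_prod (Suc (Suc m)) (Suc (Suc m)) $ (fib (Suc m) + k)"
    using assms by (intro trunc_prod_nth_low[symmetric]) simp_all
  \<comment> \<open>Both cross terms are read at \<open>k\<close>, where they equal
    \<open>c_seq k\<close>, and their weights add up to 1. The index of the last term truncates to
    0.\<close>
  also have "\<dots> = trunc_prod (Suc m) (Suc m) $ (fib (Suc m) + k) + c_seq k"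
    using assms k
    by (simp add: trunc_prod_diag_nth trunc_prod_nth_low sigma_cnj_combine mult_2 del: fib.simps)
  finally show ?thesis by simp
qed

theorem theorem5p1:
  fixes n k :: nat
  assumes "2 \<le> n" and "k \<le> fib (n - 2)"
  shows "c_seq (fib (n + 2) + k) = c_seq (fib n + k) + c_seq k + c_seq (fib (n - 1) + k)"
proof -
  obtain p where n: "n = Suc (Suc p)"
    using assms(1) by (metis add_2_eq_Suc le_Suc_ex)
  \<comment> \<open>Since \<open>p = n - 2\<close>, the indices \<open>?m1\<close> to
    \<open>?m4\<close> are n-1 to n+2.\<close>
  let ?P = trunc_prod
  let ?m1 = "Suc p" let ?m2 = "Suc ?m1" let ?m3 = "Suc ?m2" let ?m4 = "Suc ?m3"
  have k0: "k \<le> fib p" using assms(2) n by simp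
  have mono: "fib p \<le> fib ?m1" "fib ?m1 \<le> fib ?m2" by (rule fib_mono, simp)+
  have k: "k \<le> fib ?m1" "k \<le> fib ?m2" "k \<le> fib ?m3" using k0 mono by auto
  have f4: "fib ?m4 = fib ?m3 + fib ?m2" and f3: "fib ?m3 = fib ?m2 + fib ?m1" by simp_all
  have inner: "?P ?m3 ?m3 $ (fib ?m4 + k) = c_seq (fib ?m1 + k) - c_seq k"
  proof -
    \<comment> \<open>As \<open>fib ?m4 = 2 * fib ?m2 + fib ?m1\<close>, only the doubly shifted
      term of the expansion survives; the others are read beyond their degree.\<close>
    have "fib ?m4 + k - 2 * fib ?m2 = fib ?m1 + k" "fib ?m4 + k - fib ?m2 = fib ?m3 + k"
      using f4 f3 by linarith+
    moreover have "?P ?m2 ?m2 $ (fib ?m4 + k) = 0" "?P ?m1 ?m2 $ (fib ?m3 + k) = 0"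
      "?P ?m2 ?m1 $ (fib ?m3 + k) = 0"
      using f4 f3 by (intro trunc_prod_nth_high; linarith)+
    ultimately show ?thesis
      using trunc_prod_diag_nth[of ?m1 "fib ?m4 + k"] trunc_prod_diag_nth_fib[OF k0]
      by (simp del: fib.simps)
  qed
  have cross: "\<sigma> * ?P ?m2 ?m3 $ (fib ?m2 + k) + cnj \<sigma> * ?P ?m3 ?m2 $ (fib ?m2 + k)
      = c_seq (fib ?m2 + k) + c_seq k"
  proof -
    let ?d = "?P ?m2 ?m2 $ (fib ?m2 + k)"
    have "?P ?m2 ?m3 $ (fib ?m2 + k) = ?d + cnj \<sigma> * c_seq k"
      "?P ?m3 ?m2 $ (fib ?m2 + k) = ?d + \<sigma> * c_seq k"
      using k trunc_prod_nth_rec_right[of ?m2 ?m1] trunc_prod_nth_rec_left[of ?m1 ?m2]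
      by (simp_all add: trunc_prod_nth_low del: fib.simps)
    \<comment> \<open>Each correction becomes
      \<open>\<sigma> * cnj \<sigma> * c_seq k = c_seq k\<close>; of these two copies, one cancels
      the \<open>- c_seq k\<close> in \<open>?d\<close>.\<close>
    then have "\<sigma> * ?P ?m2 ?m3 $ (fib ?m2 + k) + cnj \<sigma> * ?P ?m3 ?m2 $ (fib ?m2 + k)
      = (\<sigma> * ?d + cnj \<sigma> * ?d) + 2 * (\<sigma> * cnj \<sigma>) * c_seq k"
      by (simp add: algebra_simps del: sigma_mult_cnj fib.simps)
    then show ?thesis
      using trunc_prod_diag_nth_fib[OF k(1)] by (simp add: sigma_cnj_combine del: fib.simps)
  qed
  \<comment> \<open>The second difference truncates to 0 because \<open>k \<le> fib ?m1\<close>, so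
    the doubly shifted term of the outer expansion vanishes.\<close>
  have "fib ?m4 + k - fib ?m3 = fib ?m2 + k" "fib ?m4 + k - 2 * fib ?m3 = 0"
    using f4 f3 k by linarith+
  then have "?P ?m4 ?m4 $ (fib ?m4 + k)
      = c_seq (fib ?m1 + k) - c_seq k + (c_seq (fib ?m2 + k) + c_seq k)"
    using trunc_prod_diag_nth[of ?m2 "fib ?m4 + k"] inner cross by (simp del: fib.simps)
  then have "c_seq (fib ?m4 + k) = c_seq (fib ?m2 + k) + c_seq k + c_seq (fib ?m1 + k)"
    using trunc_prod_diag_nth_fib[OF k(3)]
    by (simp add: diff_eq_eq add_ac del: fib.simps)
  then show ?thesis by (simp add: n del: fib.simps)
qed

end
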